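(* Let $X$ be a Polish metric space and let $f:X\to X$ be an invertible transformation such that both $f$ and $f^{-1}$ are Lipschitz. Suppose that $\overline{\mathcal{M}^{co}(f)}=\mathcal{M}(f)$. Then $$\{\mu\in\mathcal{M}(f): h_\mu(f)=0\}$$ is a residual subset of $\mathcal{M}(f)$.
   Context: A Polish metric space is a complete separable metric space. $\mathcal{M}(f)$ is the space of $f$-invariant Borel probability measures on $X$ endowed with the topology of weak convergence (convergence of integrals of bounded continuous functions). $\mathcal{M}^{co}(f)$ is the set of $f$-invariant periodic measures, i.e. measures of the form $\mu_x=\frac{1}{k_x}\sum_{i=0}^{k_x-1}\delta_{f^i(x)}$, where $x\in X$ is an $f$-periodic point of period $k_x$ and $\delta_y$ is the Dirac measure at $y$; the closure is taken in $\mathcal{M}(f)$. $h_\mu(f)$ is the metric (Kolmogorov–Sinai) entropy. A set is residual if it contains a countable intersection of dense open sets. *)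

theory Defs
  imports "HOL-Probability.Probability"
begin

definition invariant_measures :: "('a::topological_space \<Rightarrow> 'a) \<Rightarrow> 'a measure set" where
  "invariant_measures f =
     {\<mu>. prob_space \<mu> \<and> sets \<mu> = sets borel \<and>
          (\<forall>A\<in>sets borel. emeasure \<mu> (f -` A) = emeasure \<mu> A)}"

text \<open>The topology is generated by the preimages of open sets under the maps
  \<open>\<mu> \<mapsto> \<integral>g d\<mu>\<close>, so that convergence is convergence of the integrals of all bounded continuous
  functions; see \<open>limitin_weak_topology\<close> below.\<close>

definition weak_topology :: "'a::topological_space measure set \<Rightarrow> 'a measure topology" where
  "weak_topology M =
     topology_generated_by
       {{\<mu>\<in>M. (\<integral>x. g x \<partial>\<mu>) \<in> U} | (g :: 'a \<Rightarrow> real) U.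
          continuous_on UNIV g \<and> bounded (range g) \<and> open U}"

definition periodic_point :: "('a \<Rightarrow> 'a) \<Rightarrow> 'a \<Rightarrow> bool" where
  "periodic_point f x \<longleftrightarrow> (\<exists>k>0. (f ^^ k) x = x)"

definition period :: "('a \<Rightarrow> 'a) \<Rightarrow> 'a \<Rightarrow> nat" where
  "period f x = (LEAST k. k > 0 \<and> (f ^^ k) x = x)"

definition periodic_measure :: "('a::topological_space \<Rightarrow> 'a) \<Rightarrow> 'a \<Rightarrow> 'a measure" where
  "periodic_measure f x =
     measure_of UNIV (sets borel)
       (\<lambda>A. (\<Sum>i<period f x. emeasure (return borel ((f ^^ i) x)) A) / of_nat (period f x))"

definition periodic_measures :: "('a::topological_space \<Rightarrow> 'a) \<Rightarrow> 'a measure set" where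
  "periodic_measures f = {periodic_measure f x | x. periodic_point f x}"

definition finite_measurable_partition :: "'a::topological_space set set \<Rightarrow> bool" where
  "finite_measurable_partition P \<longleftrightarrow> finite P \<and> partition_on UNIV P \<and> P \<subseteq> sets borel"

text \<open>The term for \<open>A\<close> with \<open>\<mu> A = 0\<close> vanishes, which is the usual convention \<open>0 log 0 = 0\<close>.\<close>

definition partition_entropy :: "'a measure \<Rightarrow> 'a set set \<Rightarrow> real" where
  "partition_entropy \<mu> P = - (\<Sum>A\<in>P. measure \<mu> A * ln (measure \<mu> A))"

text \<open>The join of \<open>P, f\<^sup>-\<^sup>1 P, \<dots>, f\<^sup>-\<^sup>(\<^sup>n\<^sup>-\<^sup>1\<^sup>) P\<close>.\<close>

definition iterated_partition :: "('a \<Rightarrow> 'a) \<Rightarrow> 'a set set \<Rightarrow> nat \<Rightarrow> 'a set set" where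
  "iterated_partition f P n =
     {\<Inter>i<n. (f ^^ i) -` A i | A. \<forall>i<n. A i \<in> P} - {{}}"

definition entropy_wrt_partition :: "'a measure \<Rightarrow> ('a \<Rightarrow> 'a) \<Rightarrow> 'a set set \<Rightarrow> real" where
  "entropy_wrt_partition \<mu> f P =
     lim (\<lambda>n. partition_entropy \<mu> (iterated_partition f P n) / real n)"

definition metric_entropy :: "'a::topological_space measure \<Rightarrow> ('a \<Rightarrow> 'a) \<Rightarrow> ereal" where
  "metric_entropy \<mu> f =
     (SUP P\<in>{P. finite_measurable_partition P}. ereal (entropy_wrt_partition \<mu> f P))"

definition residual_in :: "'a topology \<Rightarrow> 'a set \<Rightarrow> bool" where
  "residual_in T S \<longleftrightarrow>
     S \<subseteq> topspace T \<and>
     (\<exists>U :: nat \<Rightarrow> 'a set.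
        (\<forall>n. openin T (U n) \<and> T closure_of (U n) = topspace T) \<and> (\<Inter>n. U n) \<subseteq> S)"

lemma topspace_weak_topology [simp]: "topspace (weak_topology M) = M"
proof -
  let ?B = "{{\<mu>\<in>M. (\<integral>x. g x \<partial>\<mu>) \<in> U} | (g :: 'a \<Rightarrow> real) U.
          continuous_on UNIV g \<and> bounded (range g) \<and> open U}"
  have "{\<mu>\<in>M. (\<integral>x. (\<lambda>_::'a. 0::real) x \<partial>\<mu>) \<in> UNIV} \<in> ?B"
  proof (intro CollectI exI conjI)
    show "{\<mu>\<in>M. (\<integral>x. (\<lambda>_::'a. 0::real) x \<partial>\<mu>) \<in> UNIV} = {\<mu>\<in>M. (\<integral>x. (\<lambda>_::'a. 0::real) x \<partial>\<mu>) \<in> UNIV}"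
      by (rule refl)
  qed simp_all
  then have "M \<in> ?B" by simp
  then have "\<Union>?B = M" by (intro equalityI Union_least Union_upper) auto
  then show ?thesis
    unfolding weak_topology_def topology_generated_by_topspace .
qed

lemma limitin_weak_topology:
  fixes M :: "'a::topological_space measure set"
  shows "limitin (weak_topology M) m l F \<longleftrightarrow>
    l \<in> M \<and> (\<forall>\<^sub>F i in F. m i \<in> M) \<and>
    (\<forall>g :: 'a \<Rightarrow> real. continuous_on UNIV g \<and> bounded (range g) \<longrightarrow>
       ((\<lambda>i. \<integral>x. g x \<partial>m i) \<longlongrightarrow> (\<integral>x. g x \<partial>l)) F)" (is "?L \<longleftrightarrow> ?R")
proof
  assume L: ?L
  have *: "\<forall>\<^sub>F i in F. m i \<in> M \<and> (\<integral>x. g x \<partial>m i) \<in> U"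
    if "continuous_on UNIV g" "bounded (range g)" "open U" "(\<integral>x. g x \<partial>l) \<in> U"
    for g :: "'a \<Rightarrow> real" and U
  proof -
    have "openin (weak_topology M) {\<mu>\<in>M. (\<integral>x. g x \<partial>\<mu>) \<in> U}"
      unfolding weak_topology_def by (rule topology_generated_by_Basis) (use that in blast)
    moreover have "l \<in> M" using L by (simp add: limitin_def)
    ultimately show ?thesis using L that(4) by (fastforce simp: limitin_def)
  qed
  have "\<forall>\<^sub>F i in F. m i \<in> M"
    using *[of "\<lambda>_. 0" UNIV] by (auto elim: eventually_mono)
  moreover have "((\<lambda>i. \<integral>x. g x \<partial>m i) \<longlongrightarrow> (\<integral>x. g x \<partial>l)) F"
    if "continuous_on UNIV g" "bounded (range g)" for g :: "'a \<Rightarrow> real"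
    by (rule topological_tendstoI) (use *[OF that] in \<open>simp add: eventually_conj_iff\<close>)
  moreover have "l \<in> M" using L by (simp add: limitin_def)
  ultimately show ?R by blast
next
  assume R: ?R
  have "\<forall>\<^sub>F i in F. m i \<in> V" if "openin (weak_topology M) V" "l \<in> V" for V
  proof -
    have "generate_topology_on
       {{\<mu>\<in>M. (\<integral>x. g x \<partial>\<mu>) \<in> U} | (g :: 'a \<Rightarrow> real) U.
          continuous_on UNIV g \<and> bounded (range g) \<and> open U} V"
      using that(1) unfolding weak_topology_def by (rule openin_topology_generated_by)
    then show ?thesis using that(2)
    proof induction
      case Empty
      then show ?case by simp
    next
      case (Int a b)
      then show ?case by (auto intro: eventually_conj)
    next
      case (UN K)
      then obtain k where "k \<in> K" "l \<in> k" by blast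
      then show ?case using UN.IH[of k] by (auto elim: eventually_mono)
    next
      case (Basis s)
      then obtain g :: "'a \<Rightarrow> real" and U where
        s: "s = {\<mu>\<in>M. (\<integral>x. g x \<partial>\<mu>) \<in> U}" "continuous_on UNIV g" "bounded (range g)" "open U"
        by blast
      then have "\<forall>\<^sub>F i in F. (\<integral>x. g x \<partial>m i) \<in> U"
        using R Basis by (intro topological_tendstoD) auto
      moreover have "\<forall>\<^sub>F i in F. m i \<in> M" using R by blast
      ultimately show ?case unfolding s(1) by (auto intro: eventually_elim2)
    qed
  qed
  then show ?L using R by (auto simp: limitin_def)
qed

lemma period_works:
  assumes "periodic_point f x"
  shows "period f x > 0" "(f ^^ period f x) x = x"
proof -
  have "period f x > 0 \<and> (f ^^ period f x) x = x"
    using assms unfolding period_def periodic_point_def by (rule LeastI_ex)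
  then show "period f x > 0" "(f ^^ period f x) x = x" by auto
qed

lemma sets_periodic_measure [simp]: "sets (periodic_measure f x) = sets borel"
  for f :: "'a::topological_space \<Rightarrow> 'a"
  unfolding periodic_measure_def
  using sets.sets_measure_of_eq[of "borel :: 'a measure"] by simp

lemma space_periodic_measure [simp]: "space (periodic_measure f x) = UNIV"
  by (simp add: periodic_measure_def space_measure_of_conv)

lemma emeasure_periodic_measure:
  assumes "A \<in> sets borel"
  shows "emeasure (periodic_measure f x) A =
    (\<Sum>i<period f x. emeasure (return borel ((f ^^ i) x)) A) / of_nat (period f x)"
proof (rule emeasure_measure_of[OF periodic_measure_def])
  show "countably_additive (sets (periodic_measure f x))
     (\<lambda>A. (\<Sum>i<period f x. emeasure (return borel ((f ^^ i) x)) A) / of_nat (period f x))"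
  proof (rule countably_additiveI)
    fix B :: "nat \<Rightarrow> _" assume B: "range B \<subseteq> sets (periodic_measure f x)" "disjoint_family B"
    have "(\<Sum>n. (\<Sum>i<period f x. emeasure (return borel ((f ^^ i) x)) (B n)) / of_nat (period f x))
      = (\<Sum>n. (\<Sum>i<period f x. emeasure (return borel ((f ^^ i) x)) (B n))) / of_nat (period f x)"
      by (rule ennreal_suminf_divide)
    also have "(\<Sum>n. (\<Sum>i<period f x. emeasure (return borel ((f ^^ i) x)) (B n)))
      = (\<Sum>i<period f x. (\<Sum>n. emeasure (return borel ((f ^^ i) x)) (B n)))"
      by (rule suminf_sum) simp
    also have "\<dots> = (\<Sum>i<period f x. emeasure (return borel ((f ^^ i) x)) (\<Union>n. B n))"
      using B by (intro sum.cong refl suminf_emeasure) auto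
    finally show "(\<Sum>n. (\<Sum>i<period f x. emeasure (return borel ((f ^^ i) x)) (B n)) / of_nat (period f x))
      = (\<Sum>i<period f x. emeasure (return borel ((f ^^ i) x)) (\<Union>n. B n)) / of_nat (period f x)" .
  qed
qed (use assms in \<open>simp_all add: positive_def\<close>)

lemma periodic_measures_subset:
  assumes "f \<in> borel_measurable borel"
  shows "periodic_measures f \<subseteq> invariant_measures f"
proof
  fix \<mu> assume "\<mu> \<in> periodic_measures f"
  then obtain x where x: "periodic_point f x" "\<mu> = periodic_measure f x"
    by (auto simp: periodic_measures_def)
  define k where "k = period f x"
  have k: "k > 0" "(f ^^ k) x = x" using period_works[OF x(1)] by (auto simp: k_def)
  have "emeasure \<mu> (space \<mu>) = 1"
  proof -
    have "emeasure \<mu> (space \<mu>) = of_nat k / of_nat k"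
      by (simp add: x(2) emeasure_periodic_measure k_def)
    also have "\<dots> = 1"
      using k(1) by (intro ennreal_divide_self) (auto simp: of_nat_less_top)
    finally show ?thesis .
  qed
  then have "prob_space \<mu>" by (rule prob_spaceI)
  moreover have "emeasure \<mu> (f -` A) = emeasure \<mu> A" if A: "A \<in> sets borel" for A
  proof -
    have fA: "f -` A \<in> sets borel" using measurable_sets[OF assms A] by simp
    define G where "G i = (indicator A ((f ^^ i) x) :: ennreal)" for i
    have Gk: "G k = G 0" by (simp add: G_def k(2))
    have "(\<Sum>i<k. G (Suc i)) = (\<Sum>i<k. G i)"
    proof -
      have "(\<Sum>i<k. G (Suc i)) = (\<Sum>i\<in>{0<..k}. G i)"
        by (rule sum.reindex_bij_witness[of _ "\<lambda>i. i - 1" Suc]) auto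
      also have "\<dots> = (\<Sum>i<k. G i)"
        by (rule sum.reindex_bij_witness[of _ "\<lambda>i. if i = 0 then k else i" "\<lambda>i. if i = k then 0 else i"])
          (use k(1) Gk in \<open>auto split: if_splits\<close>)
      finally show ?thesis .
    qed
    moreover have "emeasure \<mu> (f -` A) = (\<Sum>i<k. G (Suc i)) / of_nat k"
      using fA by (simp add: x(2) emeasure_periodic_measure k_def G_def indicator_def)
    moreover have "emeasure \<mu> A = (\<Sum>i<k. G i) / of_nat k"
      using A by (simp add: x(2) emeasure_periodic_measure k_def G_def)
    ultimately show ?thesis by simp
  qed
  ultimately show "\<mu> \<in> invariant_measures f" by (simp add: invariant_measures_def x(2))
qed

end

theory Submission
  imports Defs
begin

text \<open>If \<open>\<mu>\<close> gives mass close to \<open>1\<close> to points that shadow one periodic orbit of period \<open>k\<close> for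
  \<open>N\<close> steps, with \<open>N\<close> large compared to \<open>ln k\<close>, then the names of \<open>\<mu>\<close>-typical points with respect to
  a finite partition \<open>P\<close> are predicted, up to a small fraction of errors, by words taken from a
  codebook of about \<open>k\<^bsup>m/N\<^esup>\<close> elements; Gibbs' inequality turns this into a small upper bound for the
  entropy of \<open>P\<close>. For each precision, the measures with such a shadowing property for some periodic
  orbit contain an open set that contains all periodic measures, hence is dense.\<close>

section \<open>Entropy of finite partitions and Gibbs' inequality\<close>

text \<open>Gibbs' inequality in integrated form: \<open>q\<close> acts as a sub-probability guess
  for the masses of the cells, \<open>- ln (q A)\<close> is the code length it assigns to
  \<open>A\<close>, and the entropy never exceeds the mean code length. A pointwise majorant
  \<open>g\<close> of the code length therefore bounds the entropy by its integral.\<close>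

lemma partition_entropy_le_integral:
  fixes q :: "'a set \<Rightarrow> real"
  assumes "prob_space \<mu>" and R: "finite R" "partition_on (space \<mu>) R" "R \<subseteq> sets \<mu>"
    and q: "\<And>A. A \<in> R \<Longrightarrow> q A > 0" "sum q R \<le> 1"
    and g: "integrable \<mu> g" "\<And>A y. A \<in> R \<Longrightarrow> y \<in> A \<Longrightarrow> - ln (q A) \<le> g y"
  shows "partition_entropy \<mu> R \<le> (\<integral>y. g y \<partial>\<mu>)"
proof -
  interpret prob_space \<mu> by fact
  have int: "integrable \<mu> (indicator A :: _ \<Rightarrow> real)" if "A \<in> R" for A
    using R(3) that by (intro integrable_real_indicator) (auto simp: less_top[symmetric])
  have integral: "(\<integral>y. (\<Sum>A\<in>R. c A * indicator A y) \<partial>\<mu>) = (\<Sum>A\<in>R. c A * measure \<mu> A)"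
    for c :: "'a set \<Rightarrow> real"
    using int R(3)
    by (subst Bochner_Integration.integral_sum)
      (auto intro!: sum.cong integrable_mult_right simp: subset_eq)
  have pick: "(\<Sum>A\<in>R. c A * indicator A y) = c B" if "B \<in> R" "y \<in> B" for B y and c :: "'a set \<Rightarrow> real"
  proof -
    have "(\<Sum>A\<in>R. c A * indicator A y) = (\<Sum>A\<in>R. if A = B then c B else 0)"
    proof (rule sum.cong)
      fix A assume "A \<in> R"
      then have "A = B" if "y \<in> A"
        using that R(2) \<open>B \<in> R\<close> \<open>y \<in> B\<close> by (auto simp: partition_on_def disjoint_def)
      then show "c A * indicator A y = (if A = B then c B else 0)"
        using \<open>y \<in> B\<close> by (cases "y \<in> A") auto
    qed simp
    then show ?thesis using R(1) that(1) by simp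
  qed
  have cover: "\<exists>B\<in>R. y \<in> B" if "y \<in> space \<mu>" for y
    using that R(2) by (auto simp: partition_on_def)
  have "(\<Sum>A\<in>R. measure \<mu> A) = (\<integral>y. (\<Sum>A\<in>R. 1 * indicator A y) \<partial>\<mu>)"
    using integral[of "\<lambda>_. 1"] by simp
  also have "\<dots> = (\<integral>y. 1 \<partial>\<mu>)"
  proof (rule Bochner_Integration.integral_cong)
    fix y assume "y \<in> space \<mu>"
    then show "(\<Sum>A\<in>R. 1 * indicator A y) = (1::real)" using cover pick[of _ y "\<lambda>_. 1"] by blast
  qed simp
  also have "\<dots> = 1" by (simp add: prob_space)
  finally have total: "(\<Sum>A\<in>R. measure \<mu> A) = 1" .
  \<comment> \<open>The termwise form of Gibbs' inequality comes from
    \<open>ln z \<le> z - 1\<close> at \<open>z = q A / measure \<mu> A\<close>; summing the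
    corrections \<open>q A - measure \<mu> A\<close> over \<open>R\<close> gives at most 0.\<close>
  have "- (measure \<mu> A * ln (measure \<mu> A)) \<le> - ln (q A) * measure \<mu> A + q A - measure \<mu> A"
    if "A \<in> R" for A
  proof (cases "measure \<mu> A = 0")
    case True
    then show ?thesis using q(1)[OF that] by simp
  next
    case False
    then have p: "measure \<mu> A > 0" by (simp add: zero_less_measure_iff)
    have "measure \<mu> A * ln (q A / measure \<mu> A) \<le> measure \<mu> A * (q A / measure \<mu> A - 1)"
      using p q(1)[OF that] by (intro mult_left_mono ln_le_minus_one) auto
    then show ?thesis using p q(1)[OF that] by (simp add: ln_div algebra_simps)
  qed
  then have "partition_entropy \<mu> R \<le> (\<Sum>A\<in>R. - ln (q A) * measure \<mu> A + q A - measure \<mu> A)"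
    unfolding partition_entropy_def sum_negf[symmetric] by (intro sum_mono)
  also have "\<dots> \<le> (\<Sum>A\<in>R. - ln (q A) * measure \<mu> A)"
    using q(2) total by (simp add: sum.distrib sum_subtractf sum_negf)
  also have "\<dots> = (\<integral>y. (\<Sum>A\<in>R. - ln (q A) * indicator A y) \<partial>\<mu>)"
    by (simp only: integral)
  also have "\<dots> \<le> (\<integral>y. g y \<partial>\<mu>)"
  proof (rule integral_mono)
    fix y assume "y \<in> space \<mu>"
    then obtain B where B: "B \<in> R" "y \<in> B" using cover by blast
    show "(\<Sum>A\<in>R. - ln (q A) * indicator A y) \<le> g y"
      using g(2)[OF B] pick[OF B, of "\<lambda>A. - ln (q A)"] by simp
  qed (use g int in auto)
  finally show ?thesis .
qed

lemma partition_entropy_nonneg: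
  assumes "prob_space \<mu>"
  shows "partition_entropy \<mu> R \<ge> 0"
proof -
  interpret prob_space \<mu> by fact
  have "measure \<mu> A * ln (measure \<mu> A) \<le> 0" for A
    by (cases "measure \<mu> A = 0") (auto simp: mult_le_0_iff zero_less_measure_iff)
  then show ?thesis unfolding partition_entropy_def by (simp add: sum_nonpos)
qed

text \<open>Restricting the family of sets to indices below \<open>m\<close> puts the word into a
  finite function space, so that words can be counted and summed over.\<close>

lemma iterated_partition_word:
  assumes "A \<in> iterated_partition f P m"
  shows "\<exists>w\<in>{..<m} \<rightarrow>\<^sub>E P. A = (\<Inter>i<m. (f ^^ i) -` w i)"
proof -
  obtain B where B: "\<forall>i<m. B i \<in> P" "A = (\<Inter>i<m. (f ^^ i) -` B i)"
    using assms by (auto simp: iterated_partition_def)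
  show ?thesis
    by (rule bexI[of _ "restrict B {..<m}"]) (use B in auto)
qed

lemma finite_measurable_partition_iterated:
  assumes f: "f \<in> borel_measurable borel" and P: "finite_measurable_partition P"
  shows "finite_measurable_partition (iterated_partition f P m)"
  unfolding finite_measurable_partition_def
proof (intro conjI)
  have P': "finite P" "P \<subseteq> sets borel" "\<Union>P = UNIV" "disjoint P"
    using P by (auto simp: finite_measurable_partition_def partition_on_def)
  have fi: "(f ^^ i) -` A \<in> sets borel" if "A \<in> sets borel" for A i
    using measurable_sets[OF measurable_compose_n[OF f] that] by simp
  have "iterated_partition f P m \<subseteq> (\<lambda>w. \<Inter>i<m. (f ^^ i) -` w i) ` ({..<m} \<rightarrow>\<^sub>E P)"
  proof
    fix A assume "A \<in> iterated_partition f P m"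
    then show "A \<in> (\<lambda>w. \<Inter>i<m. (f ^^ i) -` w i) ` ({..<m} \<rightarrow>\<^sub>E P)"
      using iterated_partition_word[of A f P m] by (simp only: image_iff Bex_def)
  qed
  then show "finite (iterated_partition f P m)"
    by (rule finite_subset) (use P'(1) in \<open>auto intro!: finite_PiE\<close>)
  show "iterated_partition f P m \<subseteq> sets borel"
  proof
    fix A assume A: "A \<in> iterated_partition f P m"
    obtain w where w: "w \<in> {..<m} \<rightarrow>\<^sub>E P" "A = (\<Inter>i<m. (f ^^ i) -` w i)"
      using iterated_partition_word[OF A] by (rule bexE)
    show "A \<in> sets borel"
    \<comment> \<open>For \<open>m = 0\<close> the intersection is empty and equals
      \<open>UNIV\<close>; \<open>sets.finite_INT\<close> requires a nonempty index set.\<close>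
    proof (cases "m = 0")
      case False
      then have "{..<m} \<noteq> {}" by auto
      moreover have "(f ^^ i) -` w i \<in> sets borel" if "i \<in> {..<m}" for i
        using PiE_mem[OF w(1) that] P'(2) by (intro fi) blast
      ultimately show ?thesis unfolding w(2) by (intro sets.finite_INT) simp_all
    qed (simp add: w(2))
  qed
  show "partition_on UNIV (iterated_partition f P m)"
  proof (rule partition_onI)
    have "y \<in> \<Union>(iterated_partition f P m)" for y
    proof -
      have "\<exists>A. A \<in> P \<and> z \<in> A" for z
        using UNIV_I[of z] unfolding P'(3)[symmetric] by (auto simp only: Union_iff)
      then obtain B where B: "\<And>i. B i \<in> P" "\<And>i. (f ^^ i) y \<in> B i"
        using choice[of "\<lambda>i A. A \<in> P \<and> (f ^^ i) y \<in> A"] by auto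
      have y: "y \<in> (\<Inter>i<m. (f ^^ i) -` B i)" using B(2) by simp
      then have "(\<Inter>i<m. (f ^^ i) -` B i) \<in> iterated_partition f P m"
        unfolding iterated_partition_def using B(1) by (intro DiffI CollectI exI[of _ B]) blast+
      then show ?thesis using y by (rule UnionI)
    qed
    then show "\<Union>(iterated_partition f P m) = UNIV" by blast
    fix A B assume A: "A \<in> iterated_partition f P m" and B: "B \<in> iterated_partition f P m"
      and "A \<noteq> B"
    obtain v where v: "v \<in> {..<m} \<rightarrow>\<^sub>E P" "A = (\<Inter>i<m. (f ^^ i) -` v i)"
      using iterated_partition_word[OF A] by (rule bexE)
    obtain w where w: "w \<in> {..<m} \<rightarrow>\<^sub>E P" "B = (\<Inter>i<m. (f ^^ i) -` w i)"
      using iterated_partition_word[OF B] by (rule bexE)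
    show "disjnt A B"
    proof (rule ccontr)
      assume "\<not> disjnt A B"
      then obtain y where y: "y \<in> A" "y \<in> B" by (auto simp: disjnt_def)
      have "v i = w i" if "i < m" for i
      proof -
        have "(f ^^ i) y \<in> v i" "(f ^^ i) y \<in> w i" using y v w that by auto
        moreover have "v i \<in> P" "w i \<in> P" using v w that by auto
        ultimately show ?thesis using P'(4) unfolding disjoint_def by blast
      qed
      then have "A = B" unfolding v w by auto
      then show False using \<open>A \<noteq> B\<close> by simp
    qed
  qed (auto simp: iterated_partition_def)
qed

text \<open>Gibbs' inequality is applied to the law of a uniformly chosen codeword sent through a
  noisy channel. Choosing the codeword costs \<open>ln (card C)\<close>, each letter costs at most
  \<open>- ln (1 - t)\<close>, and each error costs at most a further
  \<open>ln (card P / t)\<close>; the expected number of errors is at most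
  \<open>m * e\<close>.\<close>

lemma partition_entropy_iterated_le:
  fixes code :: "'c \<Rightarrow> nat \<Rightarrow> 'a::topological_space set"
  assumes \<mu>: "prob_space \<mu>" "sets \<mu> = sets borel"
    and f: "f \<in> borel_measurable borel" and P: "finite_measurable_partition P"
    and t: "0 < t" "t < 1" and C: "finite C"
    and E: "\<And>i. i < m \<Longrightarrow> E i \<in> sets borel" "\<And>i. i < m \<Longrightarrow> measure \<mu> (E i) \<le> e"
    and code: "\<And>y. \<exists>c\<in>C. \<forall>i<m. y \<notin> E i \<longrightarrow> (f ^^ i) y \<in> code c i \<and> code c i \<in> P"
  shows "partition_entropy \<mu> (iterated_partition f P m)
    \<le> ln (card C) + m * (- ln (1 - t) + e * ln (card P / t))"
proof -
  interpret prob_space \<mu> by fact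
  have [simp]: "space \<mu> = UNIV" using sets_eq_imp_space_eq[OF \<mu>(2)] by simp
  have P': "finite P" "\<Union>P = UNIV" "disjoint P"
    using P by (auto simp: finite_measurable_partition_def partition_on_def)
  have IP: "finite_measurable_partition (iterated_partition f P m)"
    by (rule finite_measurable_partition_iterated[OF f P])
  have "P \<noteq> {}" using P'(2) by auto
  then have r: "card P \<ge> 1" using P'(1) by (simp add: Suc_le_eq card_gt_0_iff)
  have "C \<noteq> {}" using code by fast
  then have M: "card C \<ge> 1" using C by (simp add: Suc_le_eq card_gt_0_iff)
  \<comment> \<open>The channel: the codeword letter \<open>b\<close> is kept with weight
    \<open>1 - t\<close>, and every other letter \<open>a\<close> receives weight
    \<open>t / card P\<close>.\<close>
  define T where "T a b = (if a = b then 1 - t else t / card P)" for a b :: "'a set"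
  have T_pos: "T a b > 0" for a b using t r by (simp add: T_def)
  \<comment> \<open>The letter \<open>b\<close> may lie outside \<open>P\<close>, because
    \<open>code\<close> is unconstrained at error positions; the weights then sum to
    \<open>t\<close>.\<close>
  have T_sum: "(\<Sum>a\<in>P. T a b) \<le> 1" for b
  proof -
    have "(\<Sum>a\<in>P. T a b) \<le> (\<Sum>a\<in>P. (if a = b then 1 - t else 0) + t / card P)"
      using t by (intro sum_mono) (auto simp: T_def)
    also have "\<dots> = (if b \<in> P then 1 - t else 0) + t"
      using P'(1) \<open>P \<noteq> {}\<close> by (simp add: sum.distrib)
    also have "\<dots> \<le> 1" using t by auto
    finally show ?thesis .
  qed
  \<comment> \<open>The mixture over all codewords of the product laws that the channel
    produces.\<close>
  define Q where "Q w = (\<Sum>c\<in>C. \<Prod>i<m. T (w i) (code c i)) / card C" for w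
  have Q_pos: "Q w > 0" for w
    unfolding Q_def using C \<open>C \<noteq> {}\<close> M by (intro divide_pos_pos sum_pos prod_pos T_pos) auto
  have Q_sum: "sum Q ({..<m} \<rightarrow>\<^sub>E P) \<le> 1"
  proof -
    have "sum Q ({..<m} \<rightarrow>\<^sub>E P)
      = (\<Sum>c\<in>C. \<Sum>w\<in>{..<m} \<rightarrow>\<^sub>E P. \<Prod>i<m. T (w i) (code c i)) / card C"
      unfolding Q_def sum_divide_distrib[symmetric] by (subst sum.swap) simp
    also have "\<dots> = (\<Sum>c\<in>C. \<Prod>i<m. \<Sum>a\<in>P. T a (code c i)) / card C"
      using P'(1) by (subst prod_sum_PiE) auto
    also have "\<dots> \<le> (\<Sum>c\<in>C. 1) / card C"
      by (intro divide_right_mono sum_mono prod_le_1 conjI sum_nonneg T_sum less_imp_le[OF T_pos]) simp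
    also have "\<dots> = 1" using M by simp
    finally show ?thesis .
  qed
  have "\<exists>W. \<forall>A\<in>iterated_partition f P m.
      W A \<in> {..<m} \<rightarrow>\<^sub>E P \<and> A = (\<Inter>i<m. (f ^^ i) -` W A i)"
    by (rule bchoice) (use iterated_partition_word[of _ f P m] in \<open>simp only: Bex_def Ball_def, simp\<close>)
  then obtain W where "\<forall>A\<in>iterated_partition f P m.
      W A \<in> {..<m} \<rightarrow>\<^sub>E P \<and> A = (\<Inter>i<m. (f ^^ i) -` W A i)" ..
  note W = bspec[OF this, THEN conjunct1] bspec[OF this, THEN conjunct2]
  \<comment> \<open>\<open>Q\<close> is a weight on words, while Gibbs' inequality needs one on
    cells. Distinct cells have distinct words, so the total over cells is at most the total over all
    words.\<close>
  have "inj_on W (iterated_partition f P m)"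
  proof (rule inj_onI)
    fix A B assume "A \<in> iterated_partition f P m" "B \<in> iterated_partition f P m" "W A = W B"
    then show "A = B" using W(2)[of A] W(2)[of B] by (simp only:)
  qed
  then have "(\<Sum>A\<in>iterated_partition f P m. Q (W A)) = sum Q (W ` iterated_partition f P m)"
    by (simp add: sum.reindex)
  also have "\<dots> \<le> sum Q ({..<m} \<rightarrow>\<^sub>E P)"
    using P'(1) W(1) less_imp_le[OF Q_pos] by (intro sum_mono2 finite_PiE) auto
  finally have QW_sum: "(\<Sum>A\<in>iterated_partition f P m. Q (W A)) \<le> 1"
    using Q_sum by simp
  define b where "b = ln (card P / t)"
  have b: "b \<ge> 0" using r t by (simp add: b_def)
  define g where "g y = ln (card C) + (\<Sum>i<m. - ln (1 - t) + b * indicator (E i) y)" for y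
  have ind_int: "integrable \<mu> (\<lambda>y. b * indicator (E i) y)" if "i < m" for i
    using E(1)[OF that] \<mu>(2)
    by (intro integrable_mult_right integrable_real_indicator) (auto simp: less_top[symmetric])
  have term_int: "integrable \<mu> (\<lambda>y. - ln (1 - t) + b * indicator (E i) y)" if "i < m" for i
    by (intro Bochner_Integration.integrable_add integrable_const ind_int that)
  have g_int: "integrable \<mu> g"
    unfolding g_def
    by (intro Bochner_Integration.integrable_add integrable_const Bochner_Integration.integrable_sum
        term_int) simp
  have le_g: "- ln (Q (W A)) \<le> g y" if A: "A \<in> iterated_partition f P m" and y: "y \<in> A" for A y
  proof -
    obtain c where c: "c \<in> C" "\<forall>i<m. y \<notin> E i \<longrightarrow> (f ^^ i) y \<in> code c i \<and> code c i \<in> P"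
      using code by blast
    \<comment> \<open>If the true letter differs from the predicted one, disjointness of
      \<open>P\<close> forces \<open>y \<in> E i\<close>. The error cost is exactly
      \<open>b\<close>, and the additional \<open>- ln (1 - t)\<close> is nonnegative.\<close>
    have "- ln (T (W A i) (code c i)) \<le> - ln (1 - t) + b * indicator (E i) y" if i: "i < m" for i
    proof (cases "W A i = code c i")
      case True
      then show ?thesis using b by (simp add: T_def)
    next
      case False
      have "W A i \<in> P" "(f ^^ i) y \<in> W A i" using W[OF A] y i by auto
      then have "y \<in> E i"
        using False c(2) P'(3) i unfolding disjoint_def by blast
      then show ?thesis using False t r by (simp add: T_def b_def ln_div)
    qed
    then have "(\<Sum>i<m. - ln (T (W A i) (code c i))) \<le> (\<Sum>i<m. - ln (1 - t) + b * indicator (E i) y)"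
      by (intro sum_mono) auto
    moreover have "ln (\<Prod>i<m. T (W A i) (code c i)) = (\<Sum>i<m. ln (T (W A i) (code c i)))"
      by (rule ln_prod) (simp, rule less_imp_neq[THEN not_sym, OF T_pos])
    \<comment> \<open>Only the summand of the good codeword \<open>c\<close> is kept in the mixture;
      the factor \<open>1 / card C\<close> becomes the term \<open>ln (card C)\<close>.\<close>
    moreover have "ln ((\<Prod>i<m. T (W A i) (code c i)) / card C) \<le> ln (Q (W A))"
    proof (rule ln_mono)
      show "(\<Prod>i<m. T (W A i) (code c i)) / card C \<le> Q (W A)"
        unfolding Q_def using C c(1)
        by (intro divide_right_mono member_le_sum prod_nonneg less_imp_le[OF T_pos]) auto
      show "0 < (\<Prod>i<m. T (W A i) (code c i)) / card C"
        using M by (intro divide_pos_pos prod_pos T_pos) auto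
    qed
    moreover have "ln ((\<Prod>i<m. T (W A i) (code c i)) / card C)
        = ln (\<Prod>i<m. T (W A i) (code c i)) - ln (card C)"
      using M by (intro ln_divide_pos prod_pos T_pos) auto
    ultimately show ?thesis by (simp add: g_def sum_negf)
  qed
  have "partition_entropy \<mu> (iterated_partition f P m) \<le> (\<integral>y. g y \<partial>\<mu>)"
    by (rule partition_entropy_le_integral[where q="\<lambda>A. Q (W A)"])
      (use IP Q_pos QW_sum g_int le_g \<mu> in \<open>auto simp: finite_measurable_partition_def\<close>)
  also have "\<dots> = ln (card C) + (\<Sum>i<m. - ln (1 - t) + b * measure \<mu> (E i))"
  proof -
    have *: "(\<integral>y. g y \<partial>\<mu>) = ln (card C) + (\<Sum>i<m. \<integral>y. - ln (1 - t) + b * indicator (E i) y \<partial>\<mu>)"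
      unfolding g_def
      by (subst Bochner_Integration.integral_add)
        (use term_int prob_space in \<open>auto simp: Bochner_Integration.integral_sum\<close>)
    have "(\<integral>y. - ln (1 - t) + b * indicator (E i) y \<partial>\<mu>) = - ln (1 - t) + b * measure \<mu> (E i)"
      if "i < m" for i
      by (subst Bochner_Integration.integral_add[OF integrable_const ind_int[OF that]])
        (use prob_space in simp)
    then have "(\<Sum>i<m. \<integral>y. - ln (1 - t) + b * indicator (E i) y \<partial>\<mu>)
        = (\<Sum>i<m. - ln (1 - t) + b * measure \<mu> (E i))"
      by (intro sum.cong) auto
    with * show ?thesis by simp
  qed
  also have "\<dots> \<le> ln (card C) + (\<Sum>i<m. - ln (1 - t) + b * e)"
    using E(2) b by (intro add_left_mono sum_mono mult_left_mono) auto
  finally show ?thesis by (simp add: b_def mult.commute)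
qed

section \<open>Shadowing an orbit bounds the entropy\<close>

text \<open>The index \<open>j\<close> is the phase at which the orbit of \<open>x\<close> is
  joined; having only \<open>k\<close> phases is what keeps the number of codewords per block of
  length \<open>N\<close> small.\<close>

definition shadowing_set :: "('a::metric_space \<Rightarrow> 'a) \<Rightarrow> 'a \<Rightarrow> nat \<Rightarrow> nat \<Rightarrow> real \<Rightarrow> 'a set" where
  "shadowing_set f x k N \<delta> = {y. \<exists>j<k. \<forall>i<N. dist ((f ^^ i) y) ((f ^^ (i + j)) x) < \<delta>}"

lemma continuous_on_funpow:
  fixes f :: "'a::topological_space \<Rightarrow> 'a"
  assumes "continuous_on UNIV f"
  shows "continuous_on UNIV (f ^^ i)"
proof (induction i)
  case (Suc i)
  then show ?case
    using continuous_on_compose2[OF assms, of UNIV "f ^^ i"] by (simp add: comp_def)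
qed (simp add: id_def)

lemma open_shadowing_set:
  assumes "continuous_on UNIV f"
  shows "open (shadowing_set f x k N \<delta>)"
proof -
  have "shadowing_set f x k N \<delta>
      = (\<Union>j<k. \<Inter>i<N. {y. dist ((f ^^ i) y) ((f ^^ (i + j)) x) < \<delta>})"
    by (auto simp: shadowing_set_def)
  then show ?thesis
    by (auto intro!: open_Collect_less continuous_intros continuous_on_funpow[OF assms])
qed

lemma measure_vimage_funpow:
  assumes f: "f \<in> borel_measurable borel" and \<mu>: "\<mu> \<in> invariant_measures f"
    and A: "A \<in> sets borel"
  shows "measure \<mu> ((f ^^ i) -` A) = measure \<mu> A"
  using A
proof (induction i arbitrary: A)
  case (Suc i)
  have "f -` A \<in> sets borel" using measurable_sets[OF f Suc.prems] by simp
  then have "measure \<mu> ((f ^^ i) -` f -` A) = measure \<mu> (f -` A)" by (rule Suc.IH)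
  also have "\<dots> = measure \<mu> A"
    using \<mu> Suc.prems by (simp add: invariant_measures_def measure_def)
  finally show ?case by (simp add: vimage_def)
qed simp

text \<open>Time is cut into blocks of length \<open>N\<close>, and a codeword selects a phase for
  each block. If a block starts in the shadowing set, its phase predicts the letter at each time
  when the point lies in one of the compact cores \<open>K A\<close>. By invariance, at each time
  the prediction fails with probability at most \<open>\<epsilon>\<close> (outside the cores) plus
  \<open>\<delta>\<close> (bad block start).\<close>

lemma shadowing_entropy_bound:
  fixes f :: "'a::metric_space \<Rightarrow> 'a"
  assumes f: "continuous_on UNIV f" and \<mu>: "\<mu> \<in> invariant_measures f"
    and P: "finite_measurable_partition P" and t: "0 < t" "t < 1"
    and K: "\<And>A. A \<in> P \<Longrightarrow> K A \<subseteq> A" "\<And>A. A \<in> P \<Longrightarrow> compact (K A)"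
      "measure \<mu> (- (\<Union>A\<in>P. K A)) \<le> \<epsilon>"
    and sep: "\<And>A B u v. A \<in> P \<Longrightarrow> B \<in> P \<Longrightarrow> A \<noteq> B \<Longrightarrow> u \<in> K A \<Longrightarrow> v \<in> K B \<Longrightarrow> 2 * \<delta> \<le> dist u v"
    and k: "k > 0" and N: "N > 0" and V: "measure \<mu> (shadowing_set f x k N \<delta>) \<ge> 1 - \<delta>"
  shows "partition_entropy \<mu> (iterated_partition f P m)
    \<le> (real m / N + 1) * ln k + m * (- ln (1 - t) + (\<epsilon> + \<delta>) * ln (card P / t))"
proof -
  have fm: "f \<in> borel_measurable borel" using f by (rule borel_measurable_continuous_onI)
  have \<mu>': "prob_space \<mu>" and sets: "sets \<mu> = sets borel"
    using \<mu> by (auto simp: invariant_measures_def)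
  interpret prob_space \<mu> by fact
  have [simp]: "space \<mu> = UNIV" using sets_eq_imp_space_eq[OF sets] by simp
  define V where "V = shadowing_set f x k N \<delta>"
  have V_meas: "V \<in> sets borel" using open_shadowing_set[OF f] by (simp add: V_def)
  define G where "G = (\<Union>A\<in>P. K A)"
  have "closed G" unfolding G_def
    using K(2) P by (auto intro!: closed_UN compact_imp_closed simp: finite_measurable_partition_def)
  then have G_meas: "G \<in> sets borel" by simp
  have "measure \<mu> (- V) = 1 - measure \<mu> V"
    using prob_compl[of V] V_meas sets by (simp add: Compl_eq_Diff_UNIV)
  then have V_compl: "measure \<mu> (- V) \<le> \<delta>" using V by (simp add: V_def)
  \<comment> \<open>The letter predicted at position \<open>s\<close> of a block with phase
    \<open>j\<close>: the cell whose core comes within \<open>\<delta>\<close> of the orbit point.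
    The cores are \<open>2 * \<delta>\<close> apart, so at most one cell qualifies; if none does,
    the value is arbitrary.\<close>
  define wd where "wd j s = (SOME A. A \<in> P \<and> (\<exists>u\<in>K A. dist u ((f ^^ (s + j)) x) < \<delta>))" for j s
  have wd: "wd j s = A" if A: "A \<in> P" "u \<in> K A" "dist u ((f ^^ (s + j)) x) < \<delta>" for j s A u
    unfolding wd_def
  proof (rule some_equality)
    fix B assume "B \<in> P \<and> (\<exists>u\<in>K B. dist u ((f ^^ (s + j)) x) < \<delta>)"
    then obtain v where v: "B \<in> P" "v \<in> K B" "dist v ((f ^^ (s + j)) x) < \<delta>" by blast
    have "dist u v < 2 * \<delta>"
      using dist_triangle2[of u v "(f ^^ (s + j)) x"] A(3) v(3) by simp
    then show "B = A" using sep[OF A(1) v(1) _ A(2) v(2)] by fastforce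
  qed (use A in blast)
  \<comment> \<open>One block more than \<open>m div N\<close>, to cover the incomplete last
    block.\<close>
  define C where "C = {..<m div N + 1} \<rightarrow>\<^sub>E {..<k}"
  define code where "code J i = wd (J (i div N)) (i mod N)" for J i
  define E where "E i = (f ^^ i) -` (- G) \<union> (f ^^ (i div N * N)) -` (- V)" for i
  have E_meas: "(f ^^ i) -` (- G) \<in> sets borel" "(f ^^ i) -` (- V) \<in> sets borel" for i
    using measurable_sets[OF measurable_compose_n[OF fm, of i], of "- G"]
      measurable_sets[OF measurable_compose_n[OF fm, of i], of "- V"] G_meas V_meas
    by auto
  have "partition_entropy \<mu> (iterated_partition f P m)
    \<le> ln (card C) + m * (- ln (1 - t) + (\<epsilon> + \<delta>) * ln (card P / t))"
  proof (rule partition_entropy_iterated_le[OF \<mu>' sets fm P t, where E=E and code=code])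
    show "finite C" by (simp add: C_def finite_PiE)
    show "E i \<in> sets borel" for i using E_meas by (simp add: E_def)
    show "measure \<mu> (E i) \<le> \<epsilon> + \<delta>" for i
    proof -
      have "measure \<mu> (E i)
        \<le> measure \<mu> ((f ^^ i) -` (- G)) + measure \<mu> ((f ^^ (i div N * N)) -` (- V))"
        unfolding E_def using E_meas sets by (intro measure_Un_le) auto
      also have "\<dots> = measure \<mu> (- G) + measure \<mu> (- V)"
        using G_meas V_meas by (subst (1 2) measure_vimage_funpow[OF fm \<mu>]) auto
      also have "\<dots> \<le> \<epsilon> + \<delta>" using K(3) V_compl by (simp add: G_def)
      finally show ?thesis .
    qed
    fix y
    \<comment> \<open>If the block start misses \<open>V\<close>, any phase serves; one exists
      because \<open>k > 0\<close>.\<close>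
    have "\<exists>j<k. (f ^^ (l * N)) y \<in> V \<longrightarrow>
        (\<forall>i<N. dist ((f ^^ i) ((f ^^ (l * N)) y)) ((f ^^ (i + j)) x) < \<delta>)" for l
      using k unfolding V_def shadowing_set_def by blast
    then obtain J where J: "\<And>l. J l < k" "\<And>l i. (f ^^ (l * N)) y \<in> V \<Longrightarrow> i < N \<Longrightarrow>
        dist ((f ^^ i) ((f ^^ (l * N)) y)) ((f ^^ (i + J l)) x) < \<delta>"
      by metis
    show "\<exists>c\<in>C. \<forall>i<m. y \<notin> E i \<longrightarrow> (f ^^ i) y \<in> code c i \<and> code c i \<in> P"
    proof (intro bexI[of _ "restrict J {..<m div N + 1}"] allI impI)
      show "restrict J {..<m div N + 1} \<in> C" using J(1) by (auto simp: C_def)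
      fix i assume i: "i < m" "y \<notin> E i"
      then obtain A where A: "A \<in> P" "(f ^^ i) y \<in> K A" by (auto simp: E_def G_def)
      have "(f ^^ (i div N * N)) y \<in> V" using i by (auto simp: E_def)
      then have "dist ((f ^^ (i mod N)) ((f ^^ (i div N * N)) y)) ((f ^^ (i mod N + J (i div N))) x) < \<delta>"
        using N by (intro J(2)) auto
      moreover have "(f ^^ (i mod N)) ((f ^^ (i div N * N)) y) = (f ^^ i) y"
        by (metis comp_apply funpow_add mod_div_mult_eq)
      ultimately have "wd (J (i div N)) (i mod N) = A"
        using wd[OF A] by simp
      moreover have "i div N < m div N + 1"
        using i(1) by (simp add: div_le_mono less_Suc_eq_le)
      ultimately have "code (restrict J {..<m div N + 1}) i = A"
        by (simp add: code_def)
      then show "(f ^^ i) y \<in> code (restrict J {..<m div N + 1}) i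
          \<and> code (restrict J {..<m div N + 1}) i \<in> P"
        using A K(1) by auto
    qed
  qed
  moreover have "ln (card C) \<le> (real m / N + 1) * ln k"
  proof -
    have "ln (card C) = real (m div N + 1) * ln k"
      using k by (simp add: C_def card_PiE ln_realpow del: power_Suc)
    also have "\<dots> \<le> (real m / N + 1) * ln k"
      using k of_nat_div_le_of_nat[of m N, where 'a=real] by (intro mult_right_mono) auto
    finally show ?thesis .
  qed
  ultimately show ?thesis by simp
qed

section \<open>Separated compact cores of the cells\<close>

text \<open>Finite Borel measures on Polish spaces are inner regular, so each cell contains a
  compact set missing at most the share \<open>\<epsilon> / card P\<close> of mass.\<close>

lemma inner_regular_partition:
  fixes P :: "'a::polish_space set set"
  assumes "prob_space \<mu>" "sets \<mu> = sets borel" "finite_measurable_partition P" "\<epsilon> > 0"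
  obtains K where "\<And>A. A \<in> P \<Longrightarrow> K A \<subseteq> A" "\<And>A. A \<in> P \<Longrightarrow> compact (K A)"
    "measure \<mu> (- (\<Union>A\<in>P. K A)) \<le> \<epsilon>"
proof -
  interpret prob_space \<mu> by fact
  have [simp]: "space \<mu> = UNIV" using sets_eq_imp_space_eq[OF assms(2)] by simp
  have P: "finite P" "\<Union>P = UNIV" "P \<subseteq> sets borel"
    using assms(3) by (auto simp: finite_measurable_partition_def partition_on_def)
  then have "card P > 0" by (auto simp: card_gt_0_iff)
  define \<epsilon>' where "\<epsilon>' = \<epsilon> / card P"
  have "\<epsilon>' > 0" using assms(4) \<open>card P > 0\<close> by (simp add: \<epsilon>'_def)
  have "\<exists>C. C \<subseteq> A \<and> compact C \<and> measure \<mu> (A - C) \<le> \<epsilon>'" if "A \<in> P" for A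
  proof (rule ccontr)
    assume no: "\<not> ?thesis"
    have A: "A \<in> sets borel" using P that by auto
    have "emeasure \<mu> C \<le> ennreal (measure \<mu> A - \<epsilon>')" if "C \<subseteq> A" "compact C" for C
    proof -
      have "C \<in> sets borel" using that by (simp add: compact_imp_closed)
      then have "measure \<mu> (A - C) = measure \<mu> A - measure \<mu> C"
        using A that assms(2) by (intro finite_measure_Diff) auto
      then show ?thesis using no that by (auto simp: emeasure_eq_measure intro!: ennreal_leI)
    qed
    then have "(SUP C\<in>{C. C \<subseteq> A \<and> compact C}. emeasure \<mu> C) \<le> ennreal (measure \<mu> A - \<epsilon>')"
      by (intro SUP_least) auto
    then have "ennreal (measure \<mu> A) \<le> ennreal (measure \<mu> A - \<epsilon>')"
      using inner_regular[of \<mu> A] A assms(2) by (simp add: emeasure_eq_measure)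
    \<comment> \<open>\<open>ennreal\<close> sends negative reals to 0, which causes the second
      alternative. Both lead to \<open>measure \<mu> A = 0\<close>, and then the empty compact set
      already suffices.\<close>
    then have le: "measure \<mu> A \<le> measure \<mu> A - \<epsilon>' \<or> measure \<mu> A \<le> 0"
      by (auto simp: ennreal_le_iff2)
    then have "measure \<mu> A = 0" using \<open>\<epsilon>' > 0\<close> by (auto intro: antisym)
    then show False using no[simplified, rule_format, of "{}"] \<open>\<epsilon>' > 0\<close> by simp
  qed
  then obtain K where K: "\<And>A. A \<in> P \<Longrightarrow> K A \<subseteq> A" "\<And>A. A \<in> P \<Longrightarrow> compact (K A)"
    "\<And>A. A \<in> P \<Longrightarrow> measure \<mu> (A - K A) \<le> \<epsilon>'" by metis
  have meas: "A - K A \<in> sets \<mu>" if "A \<in> P" for A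
    using that P K(2)[OF that] assms(2) by (auto intro!: sets.Diff simp: compact_imp_closed)
  have "- (\<Union>A\<in>P. K A) \<subseteq> (\<Union>A\<in>P. A - K A)" using P(2) by blast
  then have "measure \<mu> (- (\<Union>A\<in>P. K A)) \<le> measure \<mu> (\<Union>A\<in>P. A - K A)"
    using P(1) meas by (intro finite_measure_mono sets.finite_UN) auto
  also have "\<dots> \<le> (\<Sum>A\<in>P. measure \<mu> (A - K A))"
    using P(1) meas by (intro finite_measure_subadditive_finite) auto
  also have "\<dots> \<le> card P * \<epsilon>'" using K(3) by (rule sum_bounded_above)
  also have "\<dots> = \<epsilon>" using \<open>card P > 0\<close> by (simp add: \<epsilon>'_def)
  finally show thesis using that K by blast
qed

text \<open>Disjoint nonempty compact sets have positive distance, so each pair tolerates all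
  sufficiently small \<open>d > 0\<close>. Combining finitely many such conditions along
  \<open>at_right 0\<close> also covers families without any pair.\<close>

lemma finite_family_compact_separated:
  fixes K :: "'i \<Rightarrow> 'a::metric_space set"
  assumes "finite I" "\<And>A. A \<in> I \<Longrightarrow> compact (K A)"
    "\<And>A B. A \<in> I \<Longrightarrow> B \<in> I \<Longrightarrow> A \<noteq> B \<Longrightarrow> K A \<inter> K B = {}"
  shows "\<exists>d>0. \<forall>A\<in>I. \<forall>B\<in>I. A \<noteq> B \<longrightarrow> (\<forall>u\<in>K A. \<forall>v\<in>K B. d \<le> dist u v)"
proof -
  have "\<forall>\<^sub>F d in at_right (0::real). A \<noteq> B \<longrightarrow> (\<forall>u\<in>K A. \<forall>v\<in>K B. d \<le> dist u v)"
    if AB: "A \<in> I" "B \<in> I" for A B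
  proof (cases "A = B \<or> K A = {} \<or> K B = {}")
    case False
    then have "setdist (K A) (K B) > 0"
      using assms(2,3) AB by (simp add: setdist_gt_0_compact_closed compact_imp_closed)
    then have "\<forall>\<^sub>F d in at_right 0. d \<in> {0<..<setdist (K A) (K B)}"
      by (rule eventually_at_right_real)
    then show ?thesis
      by eventually_elim (auto intro: order_trans[OF less_imp_le setdist_le_dist])
  qed auto
  then have "\<forall>\<^sub>F d in at_right (0::real).
      \<forall>A\<in>I. \<forall>B\<in>I. A \<noteq> B \<longrightarrow> (\<forall>u\<in>K A. \<forall>v\<in>K B. d \<le> dist u v)"
    using assms(1) by (simp add: eventually_ball_finite_distrib)
  then have "\<forall>\<^sub>F d in at_right (0::real). d > 0 \<and>
      (\<forall>A\<in>I. \<forall>B\<in>I. A \<noteq> B \<longrightarrow> (\<forall>u\<in>K A. \<forall>v\<in>K B. d \<le> dist u v))"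
    using eventually_at_right_less by (rule eventually_conj[rotated])
  then show ?thesis
    by (rule eventually_happens'[rotated]) simp
qed

section \<open>Vanishing entropy for measures that shadow at every precision\<close>

text \<open>The shadowing time \<open>Suc n * k\<close> makes \<open>ln k / N\<close> at most
  \<open>1 / Suc n\<close>, however large \<open>k\<close> is. For given \<open>\<eta>\<close>, the
  parameters are fixed in the order \<open>t\<close>, \<open>\<epsilon>\<close>, cores,
  \<open>n\<close>, \<open>k\<close>, and \<open>m\<close> tends to infinity last; each of five
  error terms is at most \<open>\<eta> / 5\<close>.\<close>

lemma entropy_wrt_partition_eq_0:
  fixes f :: "'a::polish_space \<Rightarrow> 'a"
  assumes f: "continuous_on UNIV f" and \<mu>: "\<mu> \<in> invariant_measures f"
    and P: "finite_measurable_partition P"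
    and shadow: "\<And>n. \<exists>x k. k > 0 \<and>
      measure \<mu> (shadowing_set f x k (Suc n * k) (1 / real (Suc n))) \<ge> 1 - 1 / real (Suc n)"
  shows "entropy_wrt_partition \<mu> f P = 0"
proof -
  have \<mu>': "prob_space \<mu>" "sets \<mu> = sets borel"
    using \<mu> by (auto simp: invariant_measures_def)
  have P': "finite P" "disjoint P" "P \<noteq> {}"
    using P by (auto simp: finite_measurable_partition_def partition_on_def)
  have r: "card P \<ge> 1" using P' by (simp add: Suc_le_eq card_gt_0_iff)
  define h where "h m = partition_entropy \<mu> (iterated_partition f P m) / real m" for m
  have h_nonneg: "h m \<ge> 0" for m
    using partition_entropy_nonneg[OF \<mu>'(1)] by (simp add: h_def)
  have "\<forall>\<^sub>F m in sequentially. h m < \<eta>" if "\<eta> > 0" for \<eta>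
  proof -
    \<comment> \<open>Solves \<open>- ln (1 - t) = \<eta> / 5\<close>.\<close>
    define t where "t = 1 - exp (- \<eta> / 5)"
    have t: "0 < t" "t < 1" "- ln (1 - t) = \<eta> / 5" using that by (auto simp: t_def)
    define b where "b = ln (card P / t)"
    have b: "b \<ge> 0" using r t by (simp add: b_def)
    define \<epsilon> where "\<epsilon> = \<eta> / (5 * (b + 1))"
    have \<epsilon>: "\<epsilon> > 0" "\<epsilon> * b \<le> \<eta> / 5" using that b by (auto simp: \<epsilon>_def field_simps)
    obtain K where K: "\<And>A. A \<in> P \<Longrightarrow> K A \<subseteq> A" "\<And>A. A \<in> P \<Longrightarrow> compact (K A)"
      "measure \<mu> (- (\<Union>A\<in>P. K A)) \<le> \<epsilon>"
      using inner_regular_partition[OF \<mu>' P \<epsilon>(1)] by metis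
    have disj: "K A \<inter> K B = {}" if "A \<in> P" "B \<in> P" "A \<noteq> B" for A B
      using that K(1) P'(2) unfolding disjoint_def by blast
    obtain d where d: "d > 0"
      "\<forall>A\<in>P. \<forall>B\<in>P. A \<noteq> B \<longrightarrow> (\<forall>u\<in>K A. \<forall>v\<in>K B. d \<le> dist u v)"
      using finite_family_compact_separated[of P K, OF P'(1) K(2) disj] by auto
    \<comment> \<open>The three bounds on \<open>\<delta>\<close> serve
      \<open>\<delta> * b \<le> \<epsilon> * b\<close>, the separation of the cores, and the term
      \<open>ln k / N\<close>, in this order.\<close>
    have "min (min \<epsilon> (d / 2)) (\<eta> / 5) > 0" using \<epsilon>(1) d(1) that by simp
    from nat_approx_posE[OF this]
    obtain n where n: "1 / real (Suc n) < min (min \<epsilon> (d / 2)) (\<eta> / 5)" .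
    define \<delta> where "\<delta> = 1 / real (Suc n)"
    have \<delta>: "\<delta> \<le> \<epsilon>" "2 * \<delta> \<le> d" "\<delta> < \<eta> / 5" using n unfolding \<delta>_def[symmetric] by auto
    obtain x k where k: "k > 0" and V: "measure \<mu> (shadowing_set f x k (Suc n * k) \<delta>) \<ge> 1 - \<delta>"
      using shadow[of n] unfolding \<delta>_def by blast
    have lnk: "ln k / (Suc n * k) \<le> \<delta>"
    proof -
      have "ln k \<le> real k" using k ln_le_minus_one[of "real k"] by simp
      then have "ln k / (Suc n * k) \<le> real k / (Suc n * k)" by (intro divide_right_mono) auto
      also have "\<dots> = \<delta>" using k by (simp add: \<delta>_def del: of_nat_Suc mult_Suc)
      finally show ?thesis .
    qed
    have "((\<lambda>m. ln k / real m) \<longlongrightarrow> 0) sequentially"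
      by (rule lim_const_over_n)
    then have "\<forall>\<^sub>F m in sequentially. ln k / real m < \<eta> / 5"
      using that by (intro order_tendstoD) auto
    then show "\<forall>\<^sub>F m in sequentially. h m < \<eta>"
      using eventually_gt_at_top[of 0]
    proof eventually_elim
      case (elim m)
      have "partition_entropy \<mu> (iterated_partition f P m)
        \<le> (real m / real (Suc n * k) + 1) * ln k + m * (- ln (1 - t) + (\<epsilon> + \<delta>) * ln (card P / t))"
        by (rule shadowing_entropy_bound[OF f \<mu> P t(1,2) K _ k _ V])
          (use d(2) \<delta>(2) k in \<open>fastforce\<close>)+
      then have "h m \<le> ((real m / real (Suc n * k) + 1) * ln k
          + m * (- ln (1 - t) + (\<epsilon> + \<delta>) * b)) / m"
        unfolding h_def b_def by (intro divide_right_mono) auto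
      also have "\<dots> = ln k / (Suc n * k) + ln k / m + (\<eta> / 5 + (\<epsilon> + \<delta>) * b)"
      proof -
        have "((M / N + 1) * L + M * X) / M = L / N + L / M + X" if "M > 0" for M N L X :: real
          using that by (simp add: add_divide_distrib distrib_right)
        from this[of m] show ?thesis using elim(2) unfolding t(3) by simp
      qed
      also have "\<dots> < \<eta>"
      proof -
        have "\<delta> * b \<le> \<epsilon> * b" using \<delta>(1) b by (rule mult_right_mono)
        then show ?thesis using lnk elim(1) \<epsilon>(2) \<delta>(3) unfolding distrib_right by linarith
      qed
      finally show ?case .
    qed
  qed
  \<comment> \<open>The bound holds for all large \<open>m\<close>, so the sequence itself
    converges, and this evaluates the \<open>lim\<close> in the definition of the entropy.\<close>
  then have "h \<longlonglongrightarrow> 0"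
    by (intro order_tendstoI) (auto intro!: always_eventually less_le_trans[OF _ h_nonneg])
  then show ?thesis unfolding entropy_wrt_partition_def h_def by (rule limI)
qed

section \<open>Continuous test functions that detect shadowing\<close>

text \<open>A continuous minorant of the indicator function of a shadowing set: the product over \<open>j\<close> can
  only be below \<open>\<delta>\<^sup>k\<close> if one of its factors is below \<open>\<delta>\<close>.\<close>

definition shadowing_fun :: "('a::metric_space \<Rightarrow> 'a) \<Rightarrow> 'a \<Rightarrow> nat \<Rightarrow> nat \<Rightarrow> real \<Rightarrow> 'a \<Rightarrow> real" where
  "shadowing_fun f x k N \<delta> y =
     max 0 (1 - (\<Prod>j<k. \<Sum>i<N. dist ((f ^^ i) y) ((f ^^ (i + j)) x)) / \<delta> ^ k)"

lemma continuous_shadowing_fun: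
  assumes "continuous_on UNIV f" "\<delta> > 0"
  shows "continuous_on UNIV (shadowing_fun f x k N \<delta>)"
  unfolding shadowing_fun_def
  using assms(2) by (auto intro!: continuous_intros continuous_on_funpow[OF assms(1)])

lemma shadowing_fun_le_indicator:
  assumes "\<delta> > 0"
  shows "shadowing_fun f x k N \<delta> y \<le> indicator (shadowing_set f x k N \<delta>) y"
proof (cases "y \<in> shadowing_set f x k N \<delta>")
  case True
  have "(\<Prod>j<k. \<Sum>i<N. dist ((f ^^ i) y) ((f ^^ (i + j)) x)) \<ge> 0"
    by (intro prod_nonneg sum_nonneg) auto
  then show ?thesis using True assms by (simp add: shadowing_fun_def)
next
  case False
  \<comment> \<open>For every phase some time \<open>i\<close> violates closeness, and that single
    distance already makes the sum at least \<open>\<delta>\<close>.\<close>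
  have "\<delta> \<le> (\<Sum>i<N. dist ((f ^^ i) y) ((f ^^ (i + j)) x))" if j: "j < k" for j
  proof -
    obtain i where i: "i < N" "\<delta> \<le> dist ((f ^^ i) y) ((f ^^ (i + j)) x)"
      using False j unfolding shadowing_set_def mem_Collect_eq by (meson not_less)
    show ?thesis
      using i(2) member_le_sum[of i "{..<N}" "\<lambda>i. dist ((f ^^ i) y) ((f ^^ (i + j)) x)"] i(1) by simp
  qed
  then have "(\<Prod>j<k. \<delta>) \<le> (\<Prod>j<k. \<Sum>i<N. dist ((f ^^ i) y) ((f ^^ (i + j)) x))"
    using assms by (intro prod_mono) auto
  then show ?thesis using False assms by (simp add: shadowing_fun_def)
qed

lemma shadowing_fun_nonneg: "shadowing_fun f x k N \<delta> y \<ge> 0"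
  by (simp add: shadowing_fun_def)

lemma shadowing_fun_le_1:
  assumes "\<delta> > 0"
  shows "shadowing_fun f x k N \<delta> y \<le> 1"
  by (rule order_trans[OF shadowing_fun_le_indicator[OF assms]]) simp

lemma shadowing_fun_orbit:
  assumes "j < k"
  shows "shadowing_fun f x k N \<delta> ((f ^^ j) x) = 1"
proof -
  \<comment> \<open>The point shadows the orbit exactly with phase \<open>j\<close>, so the factor
    \<open>l = j\<close> vanishes.\<close>
  have "(\<Prod>l<k. \<Sum>i<N. dist ((f ^^ i) ((f ^^ j) x)) ((f ^^ (i + l)) x)) = 0"
    using assms by (intro prod_zero bexI[of _ j]) (auto simp: funpow_add)
  then show ?thesis by (simp add: shadowing_fun_def del: prod_zero_iff)
qed

text \<open>All Dirac masses sit on the orbit, so \<open>g = 1\<close> almost everywhere.\<close>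

lemma integral_periodic_measure_eq_1:
  fixes g :: "'a::topological_space \<Rightarrow> real"
  assumes f: "f \<in> borel_measurable borel" and x: "periodic_point f x"
    and g: "g \<in> borel_measurable borel" "\<And>j. j < period f x \<Longrightarrow> g ((f ^^ j) x) = 1"
  shows "(\<integral>y. g y \<partial>periodic_measure f x) = 1"
proof -
  let ?\<mu> = "periodic_measure f x"
  have "?\<mu> \<in> invariant_measures f"
    using periodic_measures_subset[OF f] x by (auto simp: periodic_measures_def)
  then interpret prob_space ?\<mu> by (simp add: invariant_measures_def)
  have "{y. g y \<noteq> 1} \<in> sets borel"
    using measurable_sets[OF g(1), of "- {1}"] by (simp add: vimage_def)
  moreover from this have "emeasure ?\<mu> {y. g y \<noteq> 1} = 0"
    using g(2) by (simp add: emeasure_periodic_measure)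
  ultimately have "AE y in ?\<mu>. g y = 1"
    by (intro AE_I[where N="{y. g y \<noteq> 1}"]) auto
  moreover have "g \<in> borel_measurable ?\<mu>"
    using g(1) by (simp cong: measurable_cong_sets)
  ultimately have "(\<integral>y. g y \<partial>?\<mu>) = (\<integral>y. 1 \<partial>?\<mu>)"
    by (intro integral_cong_AE) auto
  then show ?thesis using prob_space by simp
qed

section \<open>Residuality of zero entropy\<close>

theorem theorem5p1:
  fixes f :: "'a::polish_space \<Rightarrow> 'a"
  assumes "bij f"
    and "\<exists>L. L-lipschitz_on UNIV f"
    and "\<exists>L. L-lipschitz_on UNIV (inv f)"
    and "weak_topology (invariant_measures f) closure_of periodic_measures f = invariant_measures f"
  shows "residual_in (weak_topology (invariant_measures f))
           {\<mu> \<in> invariant_measures f. metric_entropy \<mu> f = 0}"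
proof -
  let ?M = "invariant_measures f"
  have f: "continuous_on UNIV f" using assms(2) lipschitz_on_continuous_on by blast
  have fm: "f \<in> borel_measurable borel" using f by (rule borel_measurable_continuous_onI)
  define \<delta> where "\<delta> n = 1 / real (Suc n)" for n
  have \<delta>: "\<delta> n > 0" for n by (simp add: \<delta>_def)
  define G where "G n x = shadowing_fun f x (period f x) (Suc n * period f x) (\<delta> n)" for n x
  have G_cont: "continuous_on UNIV (G n x)" for n x
    unfolding G_def by (rule continuous_shadowing_fun[OF f \<delta>])
  have G_le_1: "G n x y \<le> 1" and G_nonneg: "0 \<le> G n x y" for n x y
    unfolding G_def by (auto intro: shadowing_fun_nonneg shadowing_fun_le_1[OF \<delta>])
  have G_bdd: "bounded (range (G n x))" for n x
    unfolding bounded_iff using G_le_1 G_nonneg by (auto intro!: exI[of _ 1])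
  \<comment> \<open>Measures whose test integral for some periodic orbit exceeds
    \<open>1 - \<delta> n\<close>; for a fixed orbit this is a subbasic open set of the weak
    topology.\<close>
  define U where "U n = (\<Union>x\<in>Collect (periodic_point f).
      {\<mu> \<in> ?M. (\<integral>y. G n x y \<partial>\<mu>) \<in> {1 - \<delta> n<..}})" for n
  have U_open: "openin (weak_topology ?M) (U n)" for n
    unfolding U_def
  proof (intro openin_Union ballI, clarify)
    fix x
    show "openin (weak_topology ?M) {\<mu> \<in> ?M. (\<integral>y. G n x y \<partial>\<mu>) \<in> {1 - \<delta> n<..}}"
      unfolding weak_topology_def
      by (rule topology_generated_by_Basis) (use G_cont G_bdd open_greaterThan in blast)
  qed
  have "periodic_measures f \<subseteq> U n" for n
  proof
    fix \<mu> assume \<mu>: "\<mu> \<in> periodic_measures f"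
    then obtain x where x: "periodic_point f x" "\<mu> = periodic_measure f x"
      by (auto simp: periodic_measures_def)
    have "(\<integral>y. G n x y \<partial>\<mu>) = 1" unfolding x(2)
      by (rule integral_periodic_measure_eq_1[OF fm x(1)])
        (auto simp: G_def shadowing_fun_orbit
          intro!: borel_measurable_continuous_onI continuous_shadowing_fun[OF f \<delta>])
    moreover have "\<mu> \<in> ?M" using periodic_measures_subset[OF fm] \<mu> by blast
    ultimately show "\<mu> \<in> U n" using x(1) \<delta>[of n] by (auto simp: U_def)
  qed
  \<comment> \<open>\<open>U n\<close> contains the periodic measures, which are dense by
    assumption.\<close>
  then have U_dense: "weak_topology ?M closure_of U n = ?M" for n
    using closure_of_mono[of "periodic_measures f" "U n" "weak_topology ?M"] assms(4)
      closure_of_subset_topspace[of "weak_topology ?M" "U n"] by auto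
  have "metric_entropy \<mu> f = 0" if \<mu>: "\<mu> \<in> (\<Inter>n. U n)" for \<mu>
  proof -
    have M: "\<mu> \<in> ?M" using \<mu> by (auto simp: U_def)
    then interpret prob_space \<mu> by (simp add: invariant_measures_def)
    have sets: "sets \<mu> = sets borel" using M by (simp add: invariant_measures_def)
    have "\<exists>x k. k > 0 \<and> measure \<mu> (shadowing_set f x k (Suc n * k) (\<delta> n)) \<ge> 1 - \<delta> n" for n
    proof -
      have "\<mu> \<in> U n" using \<mu> by blast
      then obtain x where x: "periodic_point f x" "(\<integral>y. G n x y \<partial>\<mu>) > 1 - \<delta> n"
        by (auto simp: U_def)
      define V where "V = shadowing_set f x (period f x) (Suc n * period f x) (\<delta> n)"
      have "V \<in> sets \<mu>" using open_shadowing_set[OF f] sets by (simp add: V_def)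
      have "G n x \<in> borel_measurable \<mu>"
        using borel_measurable_continuous_onI[OF G_cont] sets by (simp cong: measurable_cong_sets)
      then have "integrable \<mu> (G n x)"
        using G_le_1 G_nonneg by (intro integrable_const_bound[of _ 1]) auto
      \<comment> \<open>The minorant transfers the integral bound to the mass of the shadowing set,
        as required for vanishing entropy.\<close>
      then have "(\<integral>y. G n x y \<partial>\<mu>) \<le> (\<integral>y. indicator V y \<partial>\<mu>)"
        using \<open>V \<in> sets \<mu>\<close> unfolding G_def V_def
        by (intro integral_mono shadowing_fun_le_indicator \<delta> integrable_real_indicator)
          (auto simp: less_top[symmetric])
      then have "measure \<mu> V \<ge> 1 - \<delta> n" using x(2) \<open>V \<in> sets \<mu>\<close> by simp
      then show ?thesis using period_works(1)[OF x(1)] unfolding V_def by blast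
    qed
    then have 0: "entropy_wrt_partition \<mu> f P = 0" if "finite_measurable_partition P" for P
      using entropy_wrt_partition_eq_0[OF f M that] unfolding \<delta>_def by blast
    \<comment> \<open>The trivial partition makes the index set of the supremum nonempty; over the
      empty set the \<open>ereal\<close> supremum would be minus infinity.\<close>
    have "finite_measurable_partition {UNIV :: 'a set}"
      by (simp add: finite_measurable_partition_def partition_on_def)
    then have "{P :: 'a set set. finite_measurable_partition P} \<noteq> {}" by blast
    then have "(SUP P\<in>{P. finite_measurable_partition P}. ereal (entropy_wrt_partition \<mu> f P))
        = (SUP P\<in>{P :: 'a set set. finite_measurable_partition P}. 0)"
      using 0 by (intro SUP_cong) (auto simp: zero_ereal_def)
    then show ?thesis
      using \<open>_ \<noteq> {}\<close> unfolding metric_entropy_def by simp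
  qed
  moreover have "(\<Inter>n. U n) \<subseteq> ?M" by (auto simp: U_def)
  ultimately show ?thesis
    unfolding residual_in_def
    by (intro conjI exI[of _ U]) (auto simp: U_open U_dense)
qed

end
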